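(* Let $f:\mathbb{R}^n\to\mathbb{R}$ be an $L$-smooth function satisfying $\arg\min f\neq\emptyset$, and let $h>0$ and $x_k\in\mathbb{R}^n$. If $f$ satisfies the Polyak--Łojasiewicz inequality with parameter $\mu>0$ and $\nabla f(x_k)\neq0$ holds, then there exists a nontrivial (i.e. nonzero) solution $\eta_k\in\mathbb{R}$ of the nonlinear equation $F_h(\eta_k;x_k)=0$ such that $$\left(1+\frac{Lh}{2}\right)^{-1}\leq\eta_k\leq(2\mu h)^{-\frac12}.$$
   Context: A function $f$ is $L$-smooth ($L>0$) if it is differentiable and $\nabla f$ is Lipschitz continuous with constant $L$. Writing $f^\star=\min f$, $f$ satisfies the Polyak--Łojasiewicz inequality with parameter $\mu>0$ if $\frac12\|\nabla f(x)\|^2\ge\mu(f(x)-f^\star)$ for all $x\in\mathbb{R}^n$. For $h>0$, $\eta\in\mathbb{R}$ and $x\in\mathbb{R}^n$, define $$F_h(\eta;x)=f(x-\eta h\nabla f(x))-f(x)+h\eta^2\|\nabla f(x)\|^2,$$ where $\|\cdot\|$ is the Euclidean norm. The equation $F_h(\eta;x)=0$ always has the trivial solution $\eta=0$. *)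

theory Defs
  imports "HOL-Analysis.Analysis"
begin

text \<open>The gradient is meaningful only where \<open>f\<close> is differentiable; there it is the unique
  vector of \<open>GDERIV\<close>, as \<open>GDERIV_grad\<close> and \<open>grad_eqI\<close> show.\<close>

definition grad :: "(real ^ 'n \<Rightarrow> real) \<Rightarrow> real ^ 'n \<Rightarrow> real ^ 'n" where
  "grad f x = (THE g. GDERIV f x :> g)"

lemma grad_eqI:
  assumes "GDERIV f x :> g"
  shows "grad f x = g"
  unfolding grad_def
proof (rule the_equality)
  show "GDERIV f x :> g" by (fact assms)
next
  fix g' assume "GDERIV f x :> g'"
  with assms have "(\<lambda>v. inner v g') = (\<lambda>v. inner v g)"
    unfolding gderiv_def by (rule has_derivative_unique[rotated])
  then show "g' = g"
    by (metis vector_eq_ldot)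
qed

lemma GDERIV_grad:
  assumes "f differentiable (at x)"
  shows "GDERIV f x :> grad f x"
proof -
  obtain D where D: "(f has_derivative D) (at x)"
    using assms unfolding differentiable_def by blast
  then have "linear D"
    by (rule has_derivative_linear)
  then have "D = (\<lambda>v. inner v (adjoint D 1))"
    by (simp add: fun_eq_iff adjoint_works)
  with D have "GDERIV f x :> adjoint D 1"
    unfolding gderiv_def by simp
  then show ?thesis
    using grad_eqI by metis
qed

definition L_smooth :: "real \<Rightarrow> (real ^ 'n \<Rightarrow> real) \<Rightarrow> bool" where
  "L_smooth L f \<longleftrightarrow> L > 0 \<and> (\<forall>x. f differentiable (at x)) \<and> L-lipschitz_on UNIV (grad f)"

definition argmin_set :: "('a \<Rightarrow> real) \<Rightarrow> 'a set" where
  "argmin_set f = {x. is_arg_min f (\<lambda>_. True) x}"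

text \<open>The value at a chosen minimizer; meaningful only if \<open>argmin_set f\<close> is nonempty.\<close>

definition min_val :: "('a \<Rightarrow> real) \<Rightarrow> real" where
  "min_val f = f (arg_min f (\<lambda>_. True))"

lemma min_val_eq:
  assumes "x \<in> argmin_set f"
  shows "min_val f = f x"
proof -
  from assms have "is_arg_min f (\<lambda>_. True) (arg_min f (\<lambda>_. True))"
    unfolding arg_min_def argmin_set_def by (auto intro: someI)
  with assms show ?thesis
    unfolding min_val_def argmin_set_def is_arg_min_def
    by (auto simp: not_less intro: antisym)
qed

definition PL_inequality :: "real \<Rightarrow> (real ^ 'n \<Rightarrow> real) \<Rightarrow> bool" where
  "PL_inequality \<mu> f \<longleftrightarrow>
     \<mu> > 0 \<and> (\<forall>x. 1 / 2 * (norm (grad f x))\<^sup>2 \<ge> \<mu> * (f x - min_val f))"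

definition F :: "(real ^ 'n \<Rightarrow> real) \<Rightarrow> real \<Rightarrow> real \<Rightarrow> real ^ 'n \<Rightarrow> real" where
  "F f h \<eta> x = f (x - (\<eta> * h) *\<^sub>R grad f x) - f x + h * \<eta>\<^sup>2 * (norm (grad f x))\<^sup>2"

end

theory Submission
  imports Defs
begin

text \<open>Put \<open>\<eta>\<^sub>1 = inverse (1 + L h / 2)\<close>, \<open>\<eta>\<^sub>2 = (2 \<mu> h) powr (-1/2)\<close> and \<open>g = grad f x\<close>. The descent
  lemma gives \<open>F f h \<eta> x \<le> h \<eta> (\<eta> / \<eta>\<^sub>1 - 1) \<parallel>g\<parallel>\<^sup>2\<close>, which is negative for
  \<open>0 < \<eta> < \<eta>\<^sub>1\<close> and zero at \<open>\<eta>\<^sub>1\<close>. The Polyak--Lojasiewicz inequality gives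
  \<open>F f h \<eta>\<^sub>2 x \<ge> 0\<close>. Hence \<open>\<eta>\<^sub>1 \<le> \<eta>\<^sub>2\<close>, without comparing \<open>\<mu>\<close> and \<open>L\<close>, and the intermediate
  value theorem on \<open>[\<eta>\<^sub>1, \<eta>\<^sub>2]\<close> yields the solution.\<close>

text \<open>Instead of integrating the gradient, subtract the linear and quadratic terms of the
  bound from \<open>f\<close> along the segment. Cauchy-Schwarz and the Lipschitz condition make the
  derivative of the remainder \<open>\<phi>\<close> nonpositive, so
  \<open>\<phi> 1 \<le> \<phi> 0\<close>.\<close>

lemma descent_lemma:
  fixes f :: "real ^ 'n \<Rightarrow> real"
  assumes "L_smooth L f"
  shows "f (x + v) \<le> f x + inner v (grad f x) + L / 2 * (norm v)\<^sup>2"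
proof -
  define \<phi> where
    "\<phi> s = f (x + s *\<^sub>R v) - s * inner v (grad f x) - L / 2 * s\<^sup>2 * (norm v)\<^sup>2" for s
  define \<phi>' where
    "\<phi>' s = inner v (grad f (x + s *\<^sub>R v)) - inner v (grad f x) - L * s * (norm v)\<^sup>2" for s
  have "(\<phi> has_real_derivative \<phi>' s) (at s)" for s
  proof -
    have "GDERIV f (x + s *\<^sub>R v) :> grad f (x + s *\<^sub>R v)"
      using assms by (intro GDERIV_grad) (simp add: L_smooth_def)
    then have f: "(f has_derivative (\<lambda>w. inner w (grad f (x + s *\<^sub>R v)))) (at (x + s *\<^sub>R v))"
      by (simp add: gderiv_def)
    have "((\<lambda>s. x + s *\<^sub>R v) has_derivative (\<lambda>t. t *\<^sub>R v)) (at s)"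
      by (auto intro!: derivative_eq_intros)
    from has_derivative_compose[OF this f]
    have "((\<lambda>s. f (x + s *\<^sub>R v)) has_real_derivative inner v (grad f (x + s *\<^sub>R v))) (at s)"
      by (simp add: has_field_derivative_def mult.commute[of _ "inner v _"])
    then show ?thesis
      unfolding \<phi>_def \<phi>'_def by (auto intro!: derivative_eq_intros)
  qed
  moreover have "\<phi>' s \<le> 0" if "0 \<le> s" for s
  proof -
    \<comment> \<open>Since \<open>0 \<le> s\<close>, the two base points lie at distance
      \<open>s * norm v\<close>.\<close>
    have "norm (grad f (x + s *\<^sub>R v) - grad f x) \<le> L * (s * norm v)"
      using assms lipschitz_onD[of L UNIV "grad f" "x + s *\<^sub>R v" x] that
      by (simp add: L_smooth_def dist_norm)
    then have "norm v * norm (grad f (x + s *\<^sub>R v) - grad f x) \<le> norm v * (L * (s * norm v))"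
      by (intro mult_left_mono) auto
    moreover have "inner v (grad f (x + s *\<^sub>R v) - grad f x)
        \<le> norm v * norm (grad f (x + s *\<^sub>R v) - grad f x)"
      by (rule norm_cauchy_schwarz)
    ultimately show ?thesis
      by (simp add: \<phi>'_def inner_diff_right power2_eq_square algebra_simps)
  qed
  ultimately have "\<phi> 1 \<le> \<phi> 0"
    by (intro DERIV_nonpos_imp_nonincreasing[of 0 1]) auto
  then show ?thesis
    by (simp add: \<phi>_def)
qed

text \<open>This is the descent lemma for the gradient step; neither \<open>h\<close> nor
  \<open>\<eta>\<close> needs a sign.\<close>

lemma F_upper_bound:
  fixes f :: "real ^ 'n \<Rightarrow> real"
  assumes "L_smooth L f"
  shows "F f h \<eta> x \<le> h * \<eta> * (\<eta> * (1 + L * h / 2) - 1) * (norm (grad f x))\<^sup>2"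
  using descent_lemma[OF assms, of x "- (\<eta> * h) *\<^sub>R grad f x"]
  by (simp add: F_def power_mult_distrib power2_norm_eq_inner[symmetric])
    (simp add: algebra_simps power2_eq_square)

text \<open>The value after the step is at least the minimum, and the condition on
  \<open>\<eta>\<close> turns the quadratic term of \<open>F\<close> into exactly the
  Polyak--Lojasiewicz bound on \<open>f x - min_val f\<close>.\<close>

lemma F_nonneg:
  fixes f :: "real ^ 'n \<Rightarrow> real"
  assumes "argmin_set f \<noteq> {}" and "PL_inequality \<mu> f" and "2 * \<mu> * h * \<eta>\<^sup>2 = 1"
  shows "0 \<le> F f h \<eta> x"
proof -
  have \<mu>: "\<mu> > 0" and PL: "\<mu> * (f x - min_val f) \<le> 1 / 2 * (norm (grad f x))\<^sup>2"
    using assms(2) by (auto simp: PL_inequality_def)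
  \<comment> \<open>A minimizer must exist for \<open>min_val f\<close> to be the true
    minimum.\<close>
  have "min_val f \<le> f y" for y
    using assms(1) min_val_eq[of _ f]
    by (force simp: argmin_set_def is_arg_min_def not_less)
  then have "min_val f \<le> f (x - (\<eta> * h) *\<^sub>R grad f x)" .
  moreover have "h * \<eta>\<^sup>2 = 1 / (2 * \<mu>)"
    using assms(3) \<mu> by (simp add: field_simps)
  moreover have "f x - min_val f \<le> 1 / (2 * \<mu>) * (norm (grad f x))\<^sup>2"
    using PL \<mu> by (simp add: field_simps)
  ultimately show ?thesis
    by (simp add: F_def)
qed

lemma continuous_on_F:
  fixes f :: "real ^ 'n \<Rightarrow> real"
  assumes "L_smooth L f"
  shows "continuous_on S (\<lambda>\<eta>. F f h \<eta> x)"
proof -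
  have "continuous_on UNIV f"
    using assms
    by (auto simp: L_smooth_def intro!: continuous_at_imp_continuous_on
        differentiable_imp_continuous_within)
  then have "continuous_on S (\<lambda>\<eta>. f (x - (\<eta> * h) *\<^sub>R grad f x))"
    by (rule continuous_on_compose2) (auto intro!: continuous_intros)
  then show ?thesis
    unfolding F_def by (intro continuous_intros)
qed

theorem theorem3p8:
  fixes f :: "real ^ 'n \<Rightarrow> real" and L h \<mu> :: real and xk :: "real ^ 'n"
  assumes "L_smooth L f"
    and "argmin_set f \<noteq> {}"
    and "h > 0"
    and "PL_inequality \<mu> f"
    and "grad f xk \<noteq> 0"
  shows "\<exists>\<eta>k::real. \<eta>k \<noteq> 0 \<and> F f h \<eta>k xk = 0 \<and>
           inverse (1 + L * h / 2) \<le> \<eta>k \<and> \<eta>k \<le> (2 * \<mu> * h) powr (- 1 / 2)"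
proof -
  define \<eta>\<^sub>1 where "\<eta>\<^sub>1 = inverse (1 + L * h / 2)"
  define \<eta>\<^sub>2 where "\<eta>\<^sub>2 = (2 * \<mu> * h) powr (- 1 / 2)"
  have pos: "0 < 1 + L * h / 2"
    using assms(1,3) by (simp add: L_smooth_def add_pos_nonneg)
  then have \<eta>\<^sub>1: "0 < \<eta>\<^sub>1" "\<eta>\<^sub>1 * (1 + L * h / 2) = 1"
    by (simp_all add: \<eta>\<^sub>1_def)
  have \<mu>h: "0 < 2 * \<mu> * h"
    using assms(3,4) by (simp add: PL_inequality_def)
  have "0 < \<eta>\<^sub>2"
    using assms(3,4) by (simp add: \<eta>\<^sub>2_def PL_inequality_def)
  have "\<eta>\<^sub>2\<^sup>2 = (2 * \<mu> * h) powr (-1)"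
    by (simp add: \<eta>\<^sub>2_def power2_eq_square powr_add[symmetric])
  also have "\<dots> = 1 / (2 * \<mu> * h)"
    using \<mu>h by (simp only: powr_minus_divide powr_one)
  finally have "2 * \<mu> * h * \<eta>\<^sub>2\<^sup>2 = 1"
    using \<mu>h by (simp only: times_divide_eq_right mult_1_right divide_self)
  then have F2: "0 \<le> F f h \<eta>\<^sub>2 xk"
    by (rule F_nonneg[OF assms(2,4)])
  have F1: "F f h \<eta>\<^sub>1 xk \<le> 0"
    using F_upper_bound[OF assms(1), of h \<eta>\<^sub>1 xk] \<eta>\<^sub>1(2) by simp
  have "\<eta>\<^sub>1 \<le> \<eta>\<^sub>2"
  proof (rule ccontr)
    assume "\<not> \<eta>\<^sub>1 \<le> \<eta>\<^sub>2"
    then have "\<eta>\<^sub>2 * (1 + L * h / 2) < \<eta>\<^sub>1 * (1 + L * h / 2)"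
      using pos by (intro mult_strict_right_mono) auto
    then have "\<eta>\<^sub>2 * (1 + L * h / 2) - 1 < 0"
      using \<eta>\<^sub>1(2) by simp
    \<comment> \<open>The nonzero gradient makes this strict, which contradicts
      \<open>F2\<close>.\<close>
    then have "h * \<eta>\<^sub>2 * (\<eta>\<^sub>2 * (1 + L * h / 2) - 1) * (norm (grad f xk))\<^sup>2 < 0"
      using assms(3,5) \<open>0 < \<eta>\<^sub>2\<close> by (intro mult_neg_pos mult_pos_neg) auto
    with F_upper_bound[OF assms(1), of h \<eta>\<^sub>2 xk] F2 show False
      by linarith
  qed
  with F1 F2 obtain \<eta> where "\<eta>\<^sub>1 \<le> \<eta>" "\<eta> \<le> \<eta>\<^sub>2" "F f h \<eta> xk = 0"
    using IVT'[of "\<lambda>\<eta>. F f h \<eta> xk" \<eta>\<^sub>1 0 \<eta>\<^sub>2] continuous_on_F[OF assms(1)] by blast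
  \<comment> \<open>The solution is nontrivial because
    \<open>0 < \<eta>\<^sub>1 \<le> \<eta>\<close>.\<close>
  with \<eta>\<^sub>1(1) show ?thesis
    unfolding \<eta>\<^sub>1_def \<eta>\<^sub>2_def by (intro exI[of _ \<eta>]) auto
qed

end
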